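(* In the propositional proof system IRL defined in the context, the rule of transitivity of implication (hypothetical syllogism) is derivable: for all formulas $\phi,\psi,\chi$, $$\{\phi\to\psi,\ \psi\to\chi\}\vdash\phi\to\chi.$$
   Context: Language: formulas are built from a countable set $K$ of primitive propositions using the connectives $\top,\bot$ (nullary), $\neg$ (unary), $\wedge,\vee,\leftrightarrow,\to$ (binary, all syntactically independent symbols). $\neg$ binds strongest, and $\wedge,\vee$ bind more strongly than $\to,\leftrightarrow$. Schematic letters $\phi,\psi,\chi$ range over all formulas. Axiom schemas of IRL: $\phi\leftrightarrow\phi$; $\phi\wedge\psi\leftrightarrow\psi\wedge\phi$; $\phi\vee\psi\leftrightarrow\psi\vee\phi$; $(\phi\wedge\psi)\wedge\chi\leftrightarrow\phi\wedge(\psi\wedge\chi)$; $(\phi\vee\psi)\vee\chi\leftrightarrow\phi\vee(\psi\vee\chi)$; $\phi\wedge(\psi\vee\chi)\leftrightarrow(\phi\wedge\psi)\vee(\phi\wedge\chi)$; $\phi\vee(\psi\wedge\chi)\leftrightarrow(\phi\vee\psi)\wedge(\phi\vee\chi)$; $\phi\wedge\top\leftrightarrow\phi$; $\phi\vee\bot\leftrightarrow\phi$; $\phi\wedge\neg\phi\leftrightarrow\bot$; $\phi\vee\neg\phi\leftrightarrow\top$; $(\phi\to\psi)\leftrightarrow(\phi\wedge\psi\leftrightarrow\phi)$. Primitive rules of IRL: (R1) from $\phi,\psi$ infer $\phi\wedge\psi$; (R2) from $\phi\wedge\psi$ infer $\phi$; (R3) from $\phi\leftrightarrow\psi$ and $\chi$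 infer $\chi[\phi\mapsto\psi]$, where $\chi[\phi\mapsto\psi]$ is any formula obtained from $\chi$ by replacing one or more arbitrarily selected occurrences of the subformula $\phi$ by $\psi$; (R4, conditional proof) if $\{\phi\}\vdash\psi$ then $\vdash\phi\to\psi$. Derivations: for a finite set $X$ of formulas, $X\vdash y$ means there is a finite sequence of formulas ending in $y$, each member of which is a theorem or results from members of $X$ and earlier members of the sequence by R1, R2 or R3. A theorem is a formula $y$ with $\emptyset\vdash y$ (written $\vdash y$); axioms are theorems, and formulas $\phi\to\psi$ obtained by R4 are theorems. R4 applies only to derivations with the single premise $\phi$ and no other undischarged premises. A rule $X\Rightarrow y$ is derivable if $X\vdash y$. *)

theory Defs
  imports Main "HOL-Library.Countable"
begin

datatype connective = Conj | Disj | Iff | Imp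

text \<open>The four binary symbols are grouped under one constructor, so that replacement needs a single
  family of clauses. They remain pairwise distinct, and none of them abbreviates another.\<close>

datatype 'k form =
    Prim 'k
  | Top  ("\<^bold>\<top>")
  | Bot  ("\<^bold>\<bottom>")
  | Neg "'k form"  ("\<^bold>\<not> _" [80] 80)
  | Bin connective "'k form" "'k form"

abbreviation AndF :: "'k form \<Rightarrow> 'k form \<Rightarrow> 'k form"  (infix "\<^bold>\<and>" 75)
  where "\<phi> \<^bold>\<and> \<psi> \<equiv> Bin Conj \<phi> \<psi>"

abbreviation OrF :: "'k form \<Rightarrow> 'k form \<Rightarrow> 'k form"  (infix "\<^bold>\<or>" 75)
  where "\<phi> \<^bold>\<or> \<psi> \<equiv> Bin Disj \<phi> \<psi>"

abbreviation IffF :: "'k form \<Rightarrow> 'k form \<Rightarrow> 'k form"  (infix "\<^bold>\<leftrightarrow>" 65)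
  where "\<phi> \<^bold>\<leftrightarrow> \<psi> \<equiv> Bin Iff \<phi> \<psi>"

abbreviation ImpF :: "'k form \<Rightarrow> 'k form \<Rightarrow> 'k form"  (infix "\<^bold>\<rightarrow>" 65)
  where "\<phi> \<^bold>\<rightarrow> \<psi> \<equiv> Bin Imp \<phi> \<psi>"

inductive irl_axiom :: "'k form \<Rightarrow> bool" where
  iff_refl:   "irl_axiom (\<phi> \<^bold>\<leftrightarrow> \<phi>)"
| and_comm:   "irl_axiom ((\<phi> \<^bold>\<and> \<psi>) \<^bold>\<leftrightarrow> (\<psi> \<^bold>\<and> \<phi>))"
| or_comm:    "irl_axiom ((\<phi> \<^bold>\<or> \<psi>) \<^bold>\<leftrightarrow> (\<psi> \<^bold>\<or> \<phi>))"
| and_assoc:  "irl_axiom (((\<phi> \<^bold>\<and> \<psi>) \<^bold>\<and> \<chi>) \<^bold>\<leftrightarrow> (\<phi> \<^bold>\<and> (\<psi> \<^bold>\<and> \<chi>)))"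
| or_assoc:   "irl_axiom (((\<phi> \<^bold>\<or> \<psi>) \<^bold>\<or> \<chi>) \<^bold>\<leftrightarrow> (\<phi> \<^bold>\<or> (\<psi> \<^bold>\<or> \<chi>)))"
| and_or:     "irl_axiom ((\<phi> \<^bold>\<and> (\<psi> \<^bold>\<or> \<chi>)) \<^bold>\<leftrightarrow> ((\<phi> \<^bold>\<and> \<psi>) \<^bold>\<or> (\<phi> \<^bold>\<and> \<chi>)))"
| or_and:     "irl_axiom ((\<phi> \<^bold>\<or> (\<psi> \<^bold>\<and> \<chi>)) \<^bold>\<leftrightarrow> ((\<phi> \<^bold>\<or> \<psi>) \<^bold>\<and> (\<phi> \<^bold>\<or> \<chi>)))"
| and_top:    "irl_axiom ((\<phi> \<^bold>\<and> \<^bold>\<top>) \<^bold>\<leftrightarrow> \<phi>)"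
| or_bot:     "irl_axiom ((\<phi> \<^bold>\<or> \<^bold>\<bottom>) \<^bold>\<leftrightarrow> \<phi>)"
| and_neg:    "irl_axiom ((\<phi> \<^bold>\<and> \<^bold>\<not> \<phi>) \<^bold>\<leftrightarrow> \<^bold>\<bottom>)"
| or_neg:     "irl_axiom ((\<phi> \<^bold>\<or> \<^bold>\<not> \<phi>) \<^bold>\<leftrightarrow> \<^bold>\<top>)"
| imp_def:    "irl_axiom ((\<phi> \<^bold>\<rightarrow> \<psi>) \<^bold>\<leftrightarrow> ((\<phi> \<^bold>\<and> \<psi>) \<^bold>\<leftrightarrow> \<phi>))"

text \<open>\<open>replaces \<phi> \<psi> \<chi> \<chi>'\<close>: the formula \<open>\<chi>'\<close> is a possible \<open>\<chi>[\<phi> \<mapsto> \<psi>]\<close>. At least one occurrence is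
  replaced, and any larger selection is allowed, all of it simultaneous: the inserted copies of
  \<open>\<psi>\<close> are not searched again. Occurrences of one formula never overlap, so \<open>here\<close> needs no side
  condition.\<close>

inductive replaces :: "'k form \<Rightarrow> 'k form \<Rightarrow> 'k form \<Rightarrow> 'k form \<Rightarrow> bool" for \<phi> \<psi> where
  here:  "replaces \<phi> \<psi> \<phi> \<psi>"
| neg:   "replaces \<phi> \<psi> \<alpha> \<alpha>' \<Longrightarrow> replaces \<phi> \<psi> (\<^bold>\<not> \<alpha>) (\<^bold>\<not> \<alpha>')"
| left:  "replaces \<phi> \<psi> \<alpha> \<alpha>' \<Longrightarrow> replaces \<phi> \<psi> (Bin c \<alpha> \<beta>) (Bin c \<alpha>' \<beta>)"
| right: "replaces \<phi> \<psi> \<beta> \<beta>' \<Longrightarrow> replaces \<phi> \<psi> (Bin c \<alpha> \<beta>) (Bin c \<alpha> \<beta>')"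
| both:  "replaces \<phi> \<psi> \<alpha> \<alpha>' \<Longrightarrow> replaces \<phi> \<psi> \<beta> \<beta>' \<Longrightarrow> replaces \<phi> \<psi> (Bin c \<alpha> \<beta>) (Bin c \<alpha>' \<beta>')"

text \<open>One application of R1, R2 or R3 to premises taken from the set \<open>S\<close>.\<close>

inductive infers :: "'k form set \<Rightarrow> 'k form \<Rightarrow> bool" for S where
  R1: "\<phi> \<in> S \<Longrightarrow> \<psi> \<in> S \<Longrightarrow> infers S (\<phi> \<^bold>\<and> \<psi>)"
| R2: "\<phi> \<^bold>\<and> \<psi> \<in> S \<Longrightarrow> infers S \<phi>"
| R3: "\<phi> \<^bold>\<leftrightarrow> \<psi> \<in> S \<Longrightarrow> \<chi> \<in> S \<Longrightarrow> replaces \<phi> \<psi> \<chi> \<chi>' \<Longrightarrow> infers S \<chi>'"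

text \<open>Theorems are the formulas derivable from the empty set, and derivations may cite theorems, so
  the two notions are defined together, as the least relation closed under these rules. R4 is not
  among the steps inside a derivation: it only turns a completed derivation from the single premise
  \<open>\<phi>\<close> into a new theorem.\<close>

inductive derives :: "'k form set \<Rightarrow> 'k form \<Rightarrow> bool"  (infix "\<^bold>\<turnstile>" 50) where
  ax:  "irl_axiom \<phi> \<Longrightarrow> {} \<^bold>\<turnstile> \<phi>"
| R4:  "{\<phi>} \<^bold>\<turnstile> \<psi> \<Longrightarrow> {} \<^bold>\<turnstile> \<phi> \<^bold>\<rightarrow> \<psi>"
| derivation: "\<lbrakk> finite X; ys \<noteq> []; last ys = y;
      \<forall>i < length ys. {} \<^bold>\<turnstile> ys ! i \<or> infers (X \<union> set (take i ys)) (ys ! i) \<rbrakk> \<Longrightarrow> X \<^bold>\<turnstile> y"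

end

theory Submission
  imports Defs
begin

text \<open>The axiom \<open>imp_def\<close> reads \<phi> \<rightarrow> \<psi> as the equation
  \<phi> \<and> \<psi> = \<phi>, that is, \<phi> \<le> \<psi> in a meet semilattice. Transitivity is
  then a calculation: \<phi> = \<phi> \<and> \<psi> = \<phi> \<and> (\<psi> \<and> \<chi>) = (\<phi>
  \<and> \<psi>) \<and> \<chi> = \<phi> \<and> \<chi>. R4 discharges only a sole premise, so with
  two premises the implication is reached equationally. The calculation rests on
  \<open>derives_replace\<close>, which lifts R3 from single steps to derivability by concatenating
  derivations, and on \<open>derives_imp_iff\<close>, which translates between implications and
  equations.\<close>

text \<open>Only the justification of the steps is recorded, without a last formula, so that
  derivations can be concatenated freely.\<close>

definition derivation_from :: "'k form set \<Rightarrow> 'k form list \<Rightarrow> bool" where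
  "derivation_from X ys \<longleftrightarrow>
     (\<forall>i < length ys. {} \<^bold>\<turnstile> ys ! i \<or> infers (X \<union> set (take i ys)) (ys ! i))"

lemma infers_mono: "infers S y \<Longrightarrow> S \<subseteq> T \<Longrightarrow> infers T y"
  by (induction rule: infers.induct) (blast intro: infers.intros)+

text \<open>Steps of the second list keep their justification because prefixing \<open>xs\<close>
  only enlarges the stock of earlier formulas, and \<open>infers\<close> is monotone.\<close>

lemma derivation_from_append:
  assumes "derivation_from X xs" "derivation_from X ys"
  shows "derivation_from X (xs @ ys)"
  unfolding derivation_from_def
proof (intro allI impI)
  fix i
  assume i: "i < length (xs @ ys)"
  show "{} \<^bold>\<turnstile> (xs @ ys) ! i \<or> infers (X \<union> set (take i (xs @ ys))) ((xs @ ys) ! i)"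
  proof (cases "i < length xs")
    case True
    then show ?thesis
      using assms(1) by (simp add: derivation_from_def nth_append)
  next
    case False
    let ?j = "i - length xs"
    have "?j < length ys"
      using i False by simp
    then have "{} \<^bold>\<turnstile> ys ! ?j \<or> infers (X \<union> set (take ?j ys)) (ys ! ?j)"
      using assms(2) by (simp add: derivation_from_def)
    moreover have "X \<union> set (take ?j ys) \<subseteq> X \<union> set (take i (xs @ ys))"
      by auto
    ultimately show ?thesis
      using False by (auto simp: nth_append intro: infers_mono)
  qed
qed

lemma derivation_from_snoc:
  assumes "derivation_from X ys" "infers (X \<union> set ys) y"
  shows "derivation_from X (ys @ [y])"
  using assms by (auto simp: derivation_from_def nth_append less_Suc_eq)

lemma derives_finite: "X \<^bold>\<turnstile> y \<Longrightarrow> finite X"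
  by (induction rule: derives.induct) auto

text \<open>Membership of \<open>y\<close> is the useful form: after concatenation \<open>y\<close>
  need no longer be last, and rules may use any earlier member.\<close>

lemma derives_obtain_derivation:
  assumes "X \<^bold>\<turnstile> y"
  obtains ys where "derivation_from X ys" "y \<in> set ys"
proof -
  have "\<exists>ys. derivation_from X ys \<and> y \<in> set ys"
    using assms
  proof (cases rule: derives.cases)
    \<comment> \<open>Here \<open>y\<close> is itself a theorem, so citing it is a derivation of
      length one; likewise for R4.\<close>
    case ax
    then have "derivation_from X [y]"
      using assms by (simp add: derivation_from_def)
    then show ?thesis
      by force
  next
    case R4
    then have "derivation_from X [y]"
      using assms by (simp add: derivation_from_def)
    then show ?thesis
      by force
  next
    case (derivation ys)
    then show ?thesis
      unfolding derivation_from_def by (metis last_in_set)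
  qed
  then show thesis
    using that by blast
qed

lemma derives_infers:
  assumes "finite X" "derivation_from X ys" "infers (X \<union> set ys) y"
  shows "X \<^bold>\<turnstile> y"
  using derives.derivation[of X "ys @ [y]"] derivation_from_snoc[OF assms(2,3)] assms(1)
  by (simp add: derivation_from_def)

lemma derives_theorem:
  assumes "finite X" "{} \<^bold>\<turnstile> y"
  shows "X \<^bold>\<turnstile> y"
  using derives.derivation[of X "[y]"] assms by simp

lemma derives_axiom: "finite X \<Longrightarrow> irl_axiom y \<Longrightarrow> X \<^bold>\<turnstile> y"
  by (blast intro: derives_theorem derives.ax)

text \<open>A premise is not itself a step of a derivation; it enters by rewriting it with
  \<open>y \<leftrightarrow> y\<close>.\<close>

lemma derives_premise:
  assumes "finite X" "y \<in> X"
  shows "X \<^bold>\<turnstile> y"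
proof -
  have "derivation_from X [y \<^bold>\<leftrightarrow> y]"
    by (simp add: derivation_from_def derives.ax irl_axiom.iff_refl)
  moreover have "infers (X \<union> set [y \<^bold>\<leftrightarrow> y]) y"
    using assms(2) by (intro infers.R3[of y y _ y] replaces.here) auto
  ultimately show ?thesis
    using assms(1) by (blast intro: derives_infers)
qed

lemma derives_replace:
  assumes "X \<^bold>\<turnstile> \<phi> \<^bold>\<leftrightarrow> \<psi>" "X \<^bold>\<turnstile> \<chi>" "replaces \<phi> \<psi> \<chi> \<chi>'"
  shows "X \<^bold>\<turnstile> \<chi>'"
proof -
  obtain xs ys where "derivation_from X xs" "\<phi> \<^bold>\<leftrightarrow> \<psi> \<in> set xs"
    and "derivation_from X ys" "\<chi> \<in> set ys"
    using assms(1,2) by (metis derives_obtain_derivation)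
  moreover from this have "infers (X \<union> set (xs @ ys)) \<chi>'"
    using assms(3) by (intro infers.R3[of \<phi> \<psi> _ \<chi>]) auto
  ultimately show ?thesis
    using derives_finite[OF assms(1)] by (blast intro: derives_infers derivation_from_append)
qed

lemma derives_iff_mp: "X \<^bold>\<turnstile> \<phi> \<^bold>\<leftrightarrow> \<psi> \<Longrightarrow> X \<^bold>\<turnstile> \<phi> \<Longrightarrow> X \<^bold>\<turnstile> \<psi>"
  by (rule derives_replace[OF _ _ replaces.here])

lemma derives_iff_sym:
  assumes "X \<^bold>\<turnstile> \<phi> \<^bold>\<leftrightarrow> \<psi>"
  shows "X \<^bold>\<turnstile> \<psi> \<^bold>\<leftrightarrow> \<phi>"
proof (rule derives_replace[OF assms])
  show "X \<^bold>\<turnstile> \<phi> \<^bold>\<leftrightarrow> \<phi>"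
    by (intro derives_axiom derives_finite[OF assms] irl_axiom.iff_refl)
  \<comment> \<open>R3 may select occurrences, so only the left side of the reflexivity axiom is
    rewritten.\<close>
  show "replaces \<phi> \<psi> (\<phi> \<^bold>\<leftrightarrow> \<phi>) (\<psi> \<^bold>\<leftrightarrow> \<phi>)"
    by (intro replaces.left replaces.here)
qed

lemma derives_imp_iff:
  assumes "finite X"
  shows "X \<^bold>\<turnstile> \<phi> \<^bold>\<rightarrow> \<psi> \<longleftrightarrow> X \<^bold>\<turnstile> (\<phi> \<^bold>\<and> \<psi>) \<^bold>\<leftrightarrow> \<phi>"
  using derives_axiom[OF assms irl_axiom.imp_def] by (blast intro: derives_iff_mp derives_iff_sym)

theorem mainTheorem7:
  fixes \<phi> \<psi> \<chi> :: "'k :: countable form"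
  shows "{\<phi> \<^bold>\<rightarrow> \<psi>, \<psi> \<^bold>\<rightarrow> \<chi>} \<^bold>\<turnstile> \<phi> \<^bold>\<rightarrow> \<chi>"
proof -
  let ?X = "{\<phi> \<^bold>\<rightarrow> \<psi>, \<psi> \<^bold>\<rightarrow> \<chi>}"
  have fin: "finite ?X"
    by simp
  \<comment> \<open>Read from right to left, \<open>derives_imp_iff\<close> turns both goals into
    the two premises.\<close>
  have \<phi>\<psi>: "?X \<^bold>\<turnstile> (\<phi> \<^bold>\<and> \<psi>) \<^bold>\<leftrightarrow> \<phi>" and \<psi>\<chi>: "?X \<^bold>\<turnstile> (\<psi> \<^bold>\<and> \<chi>) \<^bold>\<leftrightarrow> \<psi>"
    using derives_premise[OF fin] by (simp_all flip: derives_imp_iff)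
  \<comment> \<open>Expand \<psi> to \<psi> \<and> \<chi> within \<phi> \<and> \<psi>.\<close>
  have "?X \<^bold>\<turnstile> (\<phi> \<^bold>\<and> (\<psi> \<^bold>\<and> \<chi>)) \<^bold>\<leftrightarrow> \<phi>"
    by (rule derives_replace[OF derives_iff_sym[OF \<psi>\<chi>] \<phi>\<psi>])
      (intro replaces.left replaces.right replaces.here)
  then have "?X \<^bold>\<turnstile> ((\<phi> \<^bold>\<and> \<psi>) \<^bold>\<and> \<chi>) \<^bold>\<leftrightarrow> \<phi>"
    by (rule derives_replace[OF derives_iff_sym[OF derives_axiom[OF fin irl_axiom.and_assoc]]])
      (rule replaces.left[OF replaces.here])
  \<comment> \<open>After reassociation, \<phi> \<and> \<psi> is exposed as a subformula and
    contracts to \<phi>.\<close>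
  then have "?X \<^bold>\<turnstile> (\<phi> \<^bold>\<and> \<chi>) \<^bold>\<leftrightarrow> \<phi>"
    by (rule derives_replace[OF \<phi>\<psi>]) (intro replaces.left replaces.here)
  then show ?thesis
    by (simp add: derives_imp_iff)
qed

end
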